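(* Suppose that $f$ is an entire function of the form $f(z) = 1 + a z^k + \text{(higher order terms)}$, with $a\in\mathbb{C}\setminus\{0\}$ and $k\in\mathbb{N}=\{1,2,\dots\}$, and let $\Sigma=\{0,\dots,k-1\}$. Then there exist $R>0$, a set $J = J_f\subset\Sigma$, and disjoint analytic curves $\{\gamma_j\}_{j\in\Sigma}$ such that $$\mathcal{M}(f)\cap\{z: 0<|z|\le R\} = \bigcup_{j\in J}\gamma_j,$$ and with the following properties. (a) There exists $\phi>0$ such that, for each $j\in\Sigma$, $\gamma_j = \mathcal{M}(f|_{S_j(R,\phi)})$. (b) Each $\gamma_j$ contains exactly one point of each positive modulus less than or equal to $R$. (c) Each $\gamma_j$ is tangent at the origin to the ray $\{z\in\mathbb{C}:\arg z=\omega_j\}$. In particular, $\arg z = \omega_j + O(|z|^{1/2})$ as $z\to 0$ along $\gamma_j$. (d) The cardinality $\#J$ is a multiple of the inner degree $\mu$ of $f$. Moreover, if $j,j'\in\Sigma$ and $j' = j + mk/\mu$ with $m$ an integer such that $0\le m<\mu$, then $\gamma_{j'} = e^{2\pi i m/\mu}\gamma_j$, and $j'\in J$ if and only if $j\in J$.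
   Context: For an entire function $f$, $M(r,f)=\max_{|z|=r}|f(z)|$ for $r\ge 0$, and the maximum modulus set is $\mathcal{M}(f)=\{z\in\mathbb{C}: |f(z)|=M(|z|,f)\}$. For a set $T\subset\mathbb{C}$, $$\mathcal{M}(f|_T)=\{z\in T: |f(z)|=\max_{w\in T: |w|=|z|}|f(w)|\}.$$ The inner degree of $f$ is the maximal $\mu=\mu_f\in\mathbb{N}$ such that $f(z)=\tilde f(z^\mu)$ for some entire function $\tilde f$; it always divides $k$. With a fixed choice of $\arg a$, for each $j\in\Sigma$ define the angle $\omega_j = (2j\pi-\arg a)/k$ and, for $\phi,r>0$, the sector $$S_j(r,\phi)=\{z\in\mathbb{C}: 0<|z|\le r \text{ and } |\arg z-\omega_j|<\phi\},$$ where the condition is understood for some value of $\arg z$ (i.e. modulo $2\pi$). *)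

theory Defs
  imports "HOL-Complex_Analysis.Complex_Analysis" "HOL-Library.Landau_Symbols"
begin

text \<open>For entire \<open>f\<close> and \<open>r \<ge> 0\<close> the circle is compact, so the supremum is attained and is
  the maximum.\<close>
definition max_modulus :: "real \<Rightarrow> (complex \<Rightarrow> complex) \<Rightarrow> real" where
  "max_modulus r f = (SUP z\<in>sphere 0 r. cmod (f z))"

definition max_modulus_set :: "(complex \<Rightarrow> complex) \<Rightarrow> complex set" where
  "max_modulus_set f = {z. cmod (f z) = max_modulus (cmod z) f}"

text \<open>On a subset \<open>T\<close> of the plane the maximum over \<open>{w \<in> T. |w| = |z|}\<close> need not exist (the
  sectors below are not closed); a point \<open>z\<close> belongs to the restricted set only if the maximum
  exists and is attained at \<open>z\<close>.\<close>
definition max_modulus_set_on :: "(complex \<Rightarrow> complex) \<Rightarrow> complex set \<Rightarrow> complex set" where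
  "max_modulus_set_on f T =
     {z \<in> T. \<forall>w\<in>T. cmod w = cmod z \<longrightarrow> cmod (f w) \<le> cmod (f z)}"

text \<open>Meaningful for nonconstant entire \<open>f\<close>; for constant \<open>f\<close> there is no maximal exponent.\<close>
definition inner_degree :: "(complex \<Rightarrow> complex) \<Rightarrow> nat" where
  "inner_degree f =
     (GREATEST m. m \<ge> 1 \<and> (\<exists>g. g holomorphic_on UNIV \<and> (\<forall>z. f z = g (z ^ m))))"

text \<open>Here \<open>\<alpha>\<close> is the chosen value of \<open>arg a\<close>.\<close>
definition ray_angle :: "nat \<Rightarrow> real \<Rightarrow> nat \<Rightarrow> real" where
  "ray_angle k \<alpha> j = (2 * real j * pi - \<alpha>) / real k"

text \<open>The sector around the direction \<open>\<omega>\<close>; the bound holds for some value of \<open>arg z\<close>.\<close>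
definition sector :: "real \<Rightarrow> real \<Rightarrow> real \<Rightarrow> complex set" where
  "sector \<omega> r \<phi> =
     {z. 0 < cmod z \<and> cmod z \<le> r \<and> (\<exists>\<theta>. is_Arg z \<theta> \<and> \<bar>\<theta> - \<omega>\<bar> < \<phi>)}"

text \<open>A simple regular real-analytic arc, on a nondegenerate real interval that may or may not
  contain its endpoints. A complex-valued function on a real interval is real-analytic iff it is
  the restriction of a function that is holomorphic near the interval.\<close>
definition analytic_curve :: "complex set \<Rightarrow> bool" where
  "analytic_curve C \<longleftrightarrow>
     (\<exists>(I :: real set) (g :: complex \<Rightarrow> complex).
        is_interval I \<and> interior I \<noteq> {} \<and>
        g analytic_on (complex_of_real ` I) \<and>
        inj_on g (complex_of_real ` I) \<and>
        (\<forall>t\<in>I. deriv g (complex_of_real t) \<noteq> 0) \<and>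
        C = g ` complex_of_real ` I)"

text \<open>The set \<open>C\<close> reaches the origin, and the direction \<open>z / |z|\<close> of its points converges there
  to that of the ray.\<close>
definition tangent_at_origin_to_ray :: "complex set \<Rightarrow> real \<Rightarrow> bool" where
  "tangent_at_origin_to_ray C \<omega> \<longleftrightarrow>
     0 islimpt C \<and> (sgn \<longlongrightarrow> cis \<omega>) (at 0 within C)"

end

theory Submission
  imports Defs
begin

text \<open>
  The logarithmic derivative of \<open>f\<close> near the origin can be written
  \<open>z f'(z) / f(z) = k a z\<^sup>k exp (E z)\<close> with \<open>E\<close> holomorphic and \<open>E 0 = 0\<close>
  (\<open>logarithmic_derivative_normal_form\<close>). Along the circle of radius \<open>r\<close> the derivative of
  \<open>\<bar>f\<bar>\<^sup>2\<close> with respect to the angle \<open>\<theta>\<close> is therefore a negative multiple of the sine of the phase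
  \<open>k \<theta> + \<alpha> + Im (E (r e\<^sup>i\<^sup>\<theta>))\<close>. For small \<open>r\<close> the phase is strictly increasing in \<open>\<theta>\<close>, so
  the modulus rises until the phase is \<open>2 \<pi> j\<close> and then falls, over a full period of the phase
  (\<open>norm_less_at_critical_angle\<close>). Each circle hence carries exactly \<open>k\<close> local maxima, one for each
  \<open>j < k\<close>, and the global maxima are among them.

  The points with phase \<open>2 \<pi> j\<close> are those where \<open>arg z + Im (E z) / k = \<omega>\<^sub>j\<close>, that is, where the
  locally biholomorphic map \<open>z \<mapsto> z exp (E z / k)\<close> takes values on the ray of angle \<open>\<omega>\<^sub>j\<close>. They form the
  curve \<open>\<gamma>\<^sub>j\<close>, which can be parametrised holomorphically by its own modulus \<open>r\<close>
  (\<open>level_curve_of_twisted_argument\<close>). The equation for the argument also gives the tangent direction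
  and the rate: \<open>arg z - \<omega>\<^sub>j = - Im (E z) / k = O(\<bar>z\<bar>)\<close>.

  The squared moduli of \<open>f\<close> along two of the curves are real-analytic functions of \<open>r\<close>, even at
  \<open>r = 0\<close>. So either they agree for all small \<open>r\<close>, or one of them is strictly larger for all small
  \<open>r > 0\<close> (\<open>cmod_comparison_eventually_constant\<close>). The set \<open>J\<close> of indices that attain the maximum
  is thus the same for all small radii.

  Finally, if \<open>\<mu>\<close> is the inner degree then \<open>f\<close> is invariant under rotation by \<open>2 \<pi> / \<mu>\<close>, and \<open>\<mu>\<close>
  divides \<open>k\<close>. The rotation permutes the sectors, hence the curves and the maximal ones among them, by
  shifting the index by \<open>k / \<mu>\<close>.
\<close>

section \<open>Holomorphic curves parametrised by the modulus\<close>

lemma holomorphic_local_inverse_at_0: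
  fixes F :: "complex \<Rightarrow> complex"
  assumes hol: "F holomorphic_on ball 0 \<rho>" and "\<rho> > 0" and "F 0 = 0" and "deriv F 0 \<noteq> 0"
  obtains \<epsilon> \<rho>' G where "\<epsilon> > 0" "\<rho>' > 0" "\<rho>' \<le> \<rho>" "inj_on F (ball 0 \<rho>')"
    "G holomorphic_on ball 0 \<epsilon>" "G 0 = 0"
    "\<And>w. w \<in> ball 0 \<epsilon> \<Longrightarrow> G w \<in> ball 0 \<rho>' \<and> F (G w) = w"
proof -
  obtain \<rho>' where r: "\<rho>' > 0" "ball (0::complex) \<rho>' \<subseteq> ball 0 \<rho>" "open (F ` ball 0 \<rho>')" "inj_on F (ball 0 \<rho>')"
  proof -
    have "0 \<in> ball 0 \<rho>"
      using \<open>\<rho> > 0\<close> by simp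
    show ?thesis
      by (rule has_complex_derivative_locally_invertible[OF hol \<open>0 \<in> ball 0 \<rho>\<close> open_ball assms(4)]) (rule that)
  qed
  have hol': "F holomorphic_on ball 0 \<rho>'"
    using hol r(2) holomorphic_on_subset by blast
  obtain G where G: "G holomorphic_on F ` ball 0 \<rho>'" "\<And>z. z \<in> ball 0 \<rho>' \<Longrightarrow> G (F z) = z"
    using holomorphic_has_inverse[OF hol' open_ball r(4)] by metis
  have "0 \<in> F ` ball 0 \<rho>'"
    using r(1) \<open>F 0 = 0\<close> by (metis centre_in_ball imageI)
  then obtain \<epsilon> where e: "\<epsilon> > 0" "ball 0 \<epsilon> \<subseteq> F ` ball 0 \<rho>'"
    using r(3) open_contains_ball by blast
  show ?thesis
  proof (rule that[of \<epsilon> \<rho>' G])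
    show "\<rho>' \<le> \<rho>"
      using r(1,2) by (simp add: ball_subset_ball_iff)
    show "G holomorphic_on ball 0 \<epsilon>"
      using G(1) e(2) holomorphic_on_subset by blast
    show "G 0 = 0"
      using G(2)[of 0] r(1) \<open>F 0 = 0\<close> by simp
    show "G w \<in> ball 0 \<rho>' \<and> F (G w) = w" if "w \<in> ball 0 \<epsilon>" for w
      using that e(2) G(2) by fastforce
  qed (use e r in auto)
qed

lemma holomorphic_on_ball_cnj_cnj:
  assumes "N holomorphic_on ball 0 \<epsilon>"
  shows "(\<lambda>s. cnj (N (cnj s))) holomorphic_on ball 0 \<epsilon>"
proof -
  have "cnj ` ball 0 \<epsilon> = ball 0 \<epsilon>"
    by (auto simp: image_cnj_conv_vimage_cnj)
  then show ?thesis
    using holomorphic_on_compose_cnj_cnj[of N "ball 0 \<epsilon>"] assms by (simp add: o_def)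
qed

text \<open>
  The set where \<open>arg z + Im (E z)\<close> equals \<open>\<omega>\<close> is the preimage of a ray under \<open>W z = z exp (E z)\<close>, so
  the inverse \<open>\<Psi>\<close> of \<open>W\<close> parametrises it by \<open>s = \<bar>W z\<bar>\<close>. The modulus of the point with parameter
  \<open>s\<close> is \<open>s exp (- Re (E (\<Psi> (s cis \<omega>))))\<close>. Replacing the real part by the mean of a function and its
  reflection in the real axis turns this into a holomorphic function of \<open>s\<close> with derivative \<open>1\<close> at
  \<open>0\<close>, and composing with its inverse makes the modulus itself the parameter. Injectivity of the
  resulting map is what later makes the curve regular.
\<close>

lemma level_curve_of_twisted_argument:
  fixes E :: "complex \<Rightarrow> complex" and \<omega> :: real
  assumes E: "E holomorphic_on ball 0 \<rho>" "E 0 = 0" and "\<rho> > 0"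
  obtains \<delta> g where "\<delta> > 0" "g holomorphic_on ball 0 \<delta>" "inj_on g (ball 0 \<delta>)"
    "\<And>z. z \<in> ball 0 \<delta> \<Longrightarrow> g z \<in> ball 0 \<rho>"
    "\<And>r. 0 < r \<Longrightarrow> r < \<delta> \<Longrightarrow>
       g (of_real r) = rcis r (\<omega> - Im (E (g (of_real r))))"
proof -
  define W where "W = (\<lambda>z. z * exp (E z))"
  have W_hol: "W holomorphic_on ball 0 \<rho>"
    unfolding W_def by (intro holomorphic_intros E)
  have "(E has_field_derivative deriv E 0) (at 0)"
    using E(1) \<open>\<rho> > 0\<close> by (intro holomorphic_derivI[of _ "ball 0 \<rho>"]) auto
  then have "(W has_field_derivative 1) (at 0)"
    unfolding W_def by (auto intro!: derivative_eq_intros simp: E(2))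
  then have W_deriv: "deriv W 0 = 1"
    by (rule DERIV_imp_deriv)
  obtain \<epsilon> \<rho>1 \<Psi> where Psi: "\<epsilon> > 0" "\<rho>1 > 0" "\<rho>1 \<le> \<rho>" "\<Psi> holomorphic_on ball 0 \<epsilon>" "\<Psi> 0 = 0"
    "\<And>w. w \<in> ball 0 \<epsilon> \<Longrightarrow> \<Psi> w \<in> ball 0 \<rho>1 \<and> W (\<Psi> w) = w"
    using holomorphic_local_inverse_at_0[OF W_hol \<open>\<rho> > 0\<close>] W_deriv
    by (metis W_def mult_zero_left zero_neq_one)
  define c where "c = cis \<omega>"
  have nc: "s * c \<in> ball 0 x \<longleftrightarrow> s \<in> ball 0 x" for s x
    by (simp add: c_def norm_mult)
  define N where "N = (\<lambda>s. E (\<Psi> (s * c)))"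
  have "\<Psi> \<circ> (\<lambda>s. s * c) holomorphic_on ball 0 \<epsilon>"
    by (intro holomorphic_on_compose_gen[OF _ Psi(4)] holomorphic_intros) (auto simp: nc[unfolded ball_def] c_def norm_mult)
  then have "E \<circ> (\<Psi> \<circ> (\<lambda>s. s * c)) holomorphic_on ball 0 \<epsilon>"
  proof (intro holomorphic_on_compose_gen[OF _ E(1)])
    show "(\<Psi> \<circ> (\<lambda>s. s * c)) ` ball 0 \<epsilon> \<subseteq> ball 0 \<rho>"
    proof (rule image_subsetI)
      fix s :: complex assume "s \<in> ball 0 \<epsilon>"
      then show "(\<Psi> \<circ> (\<lambda>s. s * c)) s \<in> ball 0 \<rho>"
        using Psi(3) Psi(6)[of "s * c"] nc[of s \<epsilon>] by auto
    qed
  qed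
  then have N_hol: "N holomorphic_on ball 0 \<epsilon>"
    by (simp add: N_def o_def)
  \<comment> \<open>For real \<open>s > 0\<close> this is \<open>\<bar>\<Psi> (s * c)\<bar>\<close>, in a form that is holomorphic in \<open>s\<close>.\<close>
  define P where "P = (\<lambda>s. s * exp (- (N s + cnj (N (cnj s))) / 2))"
  have P_hol: "P holomorphic_on ball 0 \<epsilon>"
    unfolding P_def by (intro holomorphic_intros holomorphic_on_ball_cnj_cnj N_hol) auto
  define Q where "Q = (\<lambda>s. exp (- (N s + cnj (N (cnj s))) / 2))"
  have "Q holomorphic_on ball 0 \<epsilon>"
    unfolding Q_def by (intro holomorphic_intros holomorphic_on_ball_cnj_cnj N_hol) auto
  then have "(Q has_field_derivative deriv Q 0) (at 0)"
    using Psi(1) by (intro holomorphic_derivI[of _ "ball 0 \<epsilon>"]) auto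
  then have "((\<lambda>s. s * Q s) has_field_derivative Q 0) (at 0)"
    by (auto intro!: derivative_eq_intros)
  moreover have "Q 0 = 1"
    by (simp add: Q_def N_def Psi(5) E(2))
  ultimately have P_deriv: "deriv P 0 = 1"
    by (simp add: P_def Q_def DERIV_imp_deriv)
  have P0: "P 0 = 0"
    by (simp add: P_def)
  obtain \<delta> \<epsilon>1 \<sigma> where sig: "\<delta> > 0" "\<epsilon>1 > 0" "\<epsilon>1 \<le> \<epsilon>" "inj_on P (ball 0 \<epsilon>1)"
    "\<sigma> holomorphic_on ball 0 \<delta>" "\<sigma> 0 = 0"
    "\<And>w. w \<in> ball 0 \<delta> \<Longrightarrow> \<sigma> w \<in> ball 0 \<epsilon>1 \<and> P (\<sigma> w) = w"
    using holomorphic_local_inverse_at_0[OF P_hol \<open>\<epsilon> > 0\<close> P0] P_deriv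
    by (metis zero_neq_one)
  define g where "g = (\<lambda>r. \<Psi> (\<sigma> r * c))"
  have sig_in: "\<sigma> r * c \<in> ball 0 \<epsilon>" if "r \<in> ball 0 \<delta>" for r
    using sig(7)[OF that] sig(3) nc by auto
  show ?thesis
  proof (rule that[of \<delta> g])
    have "\<Psi> \<circ> (\<lambda>r. \<sigma> r * c) holomorphic_on ball 0 \<delta>"
      using sig_in by (intro holomorphic_on_compose_gen[OF _ Psi(4)] holomorphic_intros sig(5)) auto
    then show "g holomorphic_on ball 0 \<delta>"
      by (simp add: g_def o_def)
    show "inj_on g (ball 0 \<delta>)"
    proof (rule inj_onI)
      fix x y assume xy: "x \<in> ball 0 \<delta>" "y \<in> ball 0 \<delta>" "g x = g y"
      then have "\<sigma> x * c = \<sigma> y * c"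
        using Psi(6)[OF sig_in] unfolding g_def by metis
      then have "\<sigma> x = \<sigma> y"
        by (simp add: c_def)
      then show "x = y"
        using sig(7) xy by metis
    qed
    show "g z \<in> ball 0 \<rho>" if "z \<in> ball 0 \<delta>" for z
      using Psi(6)[OF sig_in[OF that]] Psi(3) unfolding g_def by auto
    fix r :: real assume r: "0 < r" "r < \<delta>"
    define s where "s = Re (\<sigma> (of_real r))"
    have rb: "complex_of_real r \<in> ball 0 \<delta>"
      using r by simp
    note sr = sig(7)[OF rb]
    \<comment> \<open>\<open>P\<close> commutes with conjugation, so its inverse maps real points to real points.\<close>
    have "P (cnj (\<sigma> (of_real r))) = cnj (P (\<sigma> (of_real r)))"
      by (simp only: P_def complex_cnj_mult exp_cnj complex_cnj_divide complex_cnj_minus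
          complex_cnj_add complex_cnj_cnj complex_cnj_numeral add.commute)
    also have "\<dots> = P (\<sigma> (of_real r))"
      using sr by simp
    finally have "cnj (\<sigma> (of_real r)) = \<sigma> (of_real r)"
      by (rule inj_onD[OF sig(4)]) (use sr in auto)
    then have s: "\<sigma> (of_real r) = of_real s"
      unfolding s_def by (metis Reals_cnj_iff of_real_Re)
    have Ng: "N (of_real s) = E (g (of_real r))"
      by (simp add: N_def g_def s)
    have "N s + cnj (N s) = of_real (2 * Re (N s))"
      by (simp add: complex_add_cnj)
    then have "P (of_real s) = of_real (s * exp (- Re (N (of_real s))))"
      unfolding P_def by (simp add: exp_of_real[symmetric])
    then have req: "r = s * exp (- Re (E (g (of_real r))))"
      using sr s Ng by (metis of_real_eq_iff)
    have "W (g (of_real r)) = of_real s * c"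
      using Psi(6)[OF sig_in[OF rb]] by (simp add: g_def s)
    then have "g (of_real r) = of_real s * c * exp (- E (g (of_real r)))"
      by (simp add: W_def exp_minus field_simps)
    also have "exp (- E (g (of_real r))) =
        of_real (exp (- Re (E (g (of_real r))))) * cis (- Im (E (g (of_real r))))"
      by (simp add: exp_eq_polar)
    also have "of_real s * c * \<dots> =
        of_real (s * exp (- Re (E (g (of_real r))))) * (cis \<omega> * cis (- Im (E (g (of_real r)))))"
      by (simp add: c_def)
    also have "\<dots> = rcis r (\<omega> - Im (E (g (of_real r))))"
      by (simp only: req[symmetric] cis_mult) (simp add: rcis_def)
    finally show "g (of_real r) = rcis r (\<omega> - Im (E (g (of_real r))))" .
  qed fact
qed

text \<open>
  On the real axis \<open>\<bar>p\<bar>\<^sup>2 - \<bar>q\<bar>\<^sup>2\<close> is the restriction of the holomorphic function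
  \<open>s \<mapsto> p s * cnj (p (cnj s)) - q s * cnj (q (cnj s))\<close>. Either this vanishes identically or \<open>0\<close> is not
  an accumulation point of its zeros; in the second case the difference keeps its sign on a short
  interval to the right of \<open>0\<close> by the intermediate value theorem.
\<close>

lemma cmod_comparison_eventually_constant:
  fixes p q :: "complex \<Rightarrow> complex"
  assumes p: "p holomorphic_on ball 0 \<delta>" and q: "q holomorphic_on ball 0 \<delta>" and "\<delta> > 0"
  shows "(\<forall>\<^sub>F r in at_right 0. cmod (p (of_real r)) \<le> cmod (q (of_real r))) \<or>
         (\<forall>\<^sub>F r in at_right 0. cmod (q (of_real r)) < cmod (p (of_real r)))"
proof -
  define D where "D = (\<lambda>s. p s * cnj (p (cnj s)) - q s * cnj (q (cnj s)))"
  have D_hol: "D holomorphic_on ball 0 \<delta>"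
    unfolding D_def by (intro holomorphic_intros holomorphic_on_ball_cnj_cnj p q)
  define d where "d = (\<lambda>r::real. (cmod (p (of_real r)))\<^sup>2 - (cmod (q (of_real r)))\<^sup>2)"
  have D_real: "D (of_real r) = of_real (d r)" for r
    by (simp add: D_def d_def complex_norm_square[symmetric])
  have le: "cmod (p (of_real r)) \<le> cmod (q (of_real r)) \<longleftrightarrow> d r \<le> 0" for r
    by (simp add: d_def abs_le_square_iff[symmetric])
  have less: "cmod (q (of_real r)) < cmod (p (of_real r)) \<longleftrightarrow> d r > 0" for r
    using le[of r] by linarith
  have "(\<forall>\<^sub>F r in at_right 0. d r \<le> 0) \<or> (\<forall>\<^sub>F r in at_right 0. d r > 0)"
  proof (cases "\<forall>z\<in>ball 0 \<delta>. D z = 0")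
    case True
    then have "d r \<le> 0" if "r \<in> {0<..<\<delta>}" for r
      using that D_real[of r] by auto
    then have "\<forall>\<^sub>F r in at_right 0. d r \<le> 0"
      using \<open>\<delta> > 0\<close> eventually_at_right_less eventually_at_right_field by (auto simp: eventually_at_right_field)
    then show ?thesis ..
  next
    case False
    obtain e where e: "0 < e" "e \<le> \<delta>" "\<And>z. z \<in> ball 0 e - {0} \<Longrightarrow> D z \<noteq> 0"
    proof (cases "D 0 = 0")
      case True
      from False obtain b where b: "b \<in> ball 0 \<delta>" "D b \<noteq> 0" by blast
      then obtain e where "0 < e" "ball (0::complex) e \<subseteq> ball 0 \<delta>" "\<And>z. z \<in> ball 0 e - {0} \<Longrightarrow> D z \<noteq> 0"
      proof -
        have "0 \<in> ball 0 \<delta>"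
          using \<open>\<delta> > 0\<close> by simp
        show ?thesis
          by (rule isolated_zeros[OF D_hol open_ball connected_ball \<open>0 \<in> ball 0 \<delta>\<close> True b]) (rule that)
      qed
      then show ?thesis
        using that[of e] \<open>\<delta> > 0\<close> by (auto simp: ball_subset_ball_iff)
    next
      case nz: False
      have "isCont D 0"
        using D_hol \<open>\<delta> > 0\<close> holomorphic_on_imp_continuous_on continuous_on_interior
        by (metis centre_in_ball interior_open open_ball)
      then have "\<forall>\<^sub>F z in nhds 0. D z \<noteq> 0"
        using nz by (metis isCont_def t1_space_nhds tendsto_at_iff_tendsto_nhds tendsto_imp_eventually_ne eventually_nhds_conv_at)
      then obtain e where "e > 0" "\<And>z. dist z 0 < e \<Longrightarrow> D z \<noteq> 0"
        unfolding eventually_nhds_metric by blast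
      then show ?thesis
        using that[of "min e \<delta>"] \<open>\<delta> > 0\<close> by auto
    qed
    have nz: "d r \<noteq> 0" if "0 < r" "r < e" for r
      using e(3)[of "of_real r"] D_real[of r] that by auto
    have "continuous_on ((\<lambda>r. of_real r :: complex) ` {0<..<e}) D"
      using e(2) by (intro continuous_on_subset[OF holomorphic_on_imp_continuous_on[OF D_hol]]) auto
    then have "continuous_on {0<..<e} (\<lambda>r. D (of_real r))"
      by (intro continuous_on_compose2[where f = of_real and g = D]) (auto intro!: continuous_intros)
    then have "continuous_on {0<..<e} (\<lambda>r. Re (D (of_real r)))"
      by (intro continuous_intros)
    then have cont: "continuous_on {0<..<e} d"
      by (simp add: D_real)
    have conn: "connected (d ` {0<..<e})"
      by (intro connected_continuous_image cont) simp
    have "(\<forall>r\<in>{0<..<e}. d r \<le> 0) \<or> (\<forall>r\<in>{0<..<e}. d r > 0)"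
    proof (rule ccontr)
      assume "\<not> ?thesis"
      then obtain x y where "x \<in> {0<..<e}" "y \<in> {0<..<e}" "d x > 0" "d y \<le> 0"
        by force
      then have "0 \<in> d ` {0<..<e}"
        using connectedD_interval[OF conn, of "d y" "d x" 0] by auto
      then show False
        using nz by auto
    qed
    then show ?thesis
      using e(1) by (force simp: eventually_at_right_field)
  qed
  then show ?thesis
    by (simp only: le less)
qed

section \<open>Monotonicity of the modulus along circles\<close>

text \<open>
  Since \<open>z f'(z)\<close> vanishes to order exactly \<open>k\<close> with leading coefficient \<open>k a\<close>, the quotient of
  \<open>z f'(z) / f(z)\<close> by \<open>k a z\<^sup>k\<close> extends holomorphically with value \<open>1\<close> at \<open>0\<close>, and \<open>E\<close> is its
  logarithm. Two quantitative bounds hold on a small disc: the one on \<open>Im (E z)\<close> fixes the width of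
  the sectors, the one on \<open>z E'(z)\<close> makes the phase increase with the angle.
\<close>

lemma logarithmic_derivative_normal_form:
  fixes f h :: "complex \<Rightarrow> complex" and a :: complex and k :: nat
  assumes f: "\<And>z. f z = 1 + a * z ^ k + z ^ (k + 1) * h z"
    and h: "h holomorphic_on UNIV" and k: "k \<ge> 1" and a: "a \<noteq> 0"
  obtains \<rho> E where "\<rho> > 0" "E holomorphic_on ball 0 \<rho>" "E 0 = 0"
    "\<And>z. z \<in> ball 0 \<rho> \<Longrightarrow> f z \<noteq> 0"
    "\<And>z. z \<in> ball 0 \<rho> \<Longrightarrow> z * deriv f z = f z * (of_nat k * a * z ^ k * exp (E z))"
    "\<And>z. z \<in> ball 0 \<rho> \<Longrightarrow> \<bar>Im (E z)\<bar> < pi / 2"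
    "\<And>z. z \<in> ball 0 \<rho> \<Longrightarrow> cmod (z * deriv E z) < 1"
proof -
  have f0: "f 0 = 1"
    using k by (simp add: f)
  have f_fun: "f = (\<lambda>z. 1 + a * z ^ k + z ^ (k + 1) * h z)"
    using f by blast
  have f_hol: "f holomorphic_on UNIV"
    unfolding f_fun by (intro holomorphic_intros h)
  have h_der: "(h has_field_derivative deriv h z) (at z)" for z
    using h by (intro holomorphic_derivI[of _ UNIV]) auto
  have zk: "z * z ^ (k - 1) = z ^ k" for z :: complex
    using k by (metis power_eq_if not_one_le_zero)
  have "(f has_field_derivative
      of_nat k * a * z ^ (k - 1) + (of_nat (k + 1) * z ^ k * h z + z ^ (k + 1) * deriv h z)) (at z)" for z
    unfolding f_fun using zk[of z] by (auto intro!: derivative_eq_intros h_der simp: algebra_simps)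
  then have f_der: "deriv f z =
      of_nat k * a * z ^ (k - 1) + (of_nat (k + 1) * z ^ k * h z + z ^ (k + 1) * deriv h z)" for z
    by (rule DERIV_imp_deriv)
  define U where "U = (\<lambda>z. 1 + z * (of_nat (k + 1) * h z + z * deriv h z) / (of_nat k * a))"
  have U_hol: "U holomorphic_on UNIV"
    unfolding U_def using k a
    by (intro holomorphic_intros h holomorphic_deriv[OF h]) auto
  have zf': "z * deriv f z = of_nat k * a * z ^ k * U z" for z
  proof -
    have "z * deriv f z = of_nat k * a * (z * z ^ (k - 1)) +
        z ^ k * (z * (of_nat (k + 1) * h z + z * deriv h z))"
      by (simp add: f_der algebra_simps)
    also have "\<dots> = of_nat k * a * z ^ k * U z"
      using k a unfolding zk U_def by (simp add: field_simps)
    finally show ?thesis .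
  qed
  define Q where "Q = (\<lambda>z. U z / f z)"
  have Q0: "Q 0 = 1"
    by (simp add: Q_def U_def f0)
  have cont_f: "isCont f 0" and cont_U: "isCont U 0"
    using f_hol U_hol holomorphic_on_imp_continuous_on continuous_on_eq_continuous_at by blast+
  then have cont_Q: "isCont Q 0"
    unfolding Q_def using f0 by (intro continuous_intros) auto
  have "(f \<longlongrightarrow> 1) (nhds 0)"
    using cont_f unfolding isCont_def tendsto_at_iff_tendsto_nhds by (simp add: f0)
  then have "\<forall>\<^sub>F z in nhds 0. f z \<noteq> 0"
    by (rule tendsto_imp_eventually_ne) simp
  moreover have "((\<lambda>z. Re (Q z)) \<longlongrightarrow> 1) (nhds 0)"
    using tendsto_Re[OF cont_Q[unfolded isCont_def tendsto_at_iff_tendsto_nhds]] by (simp add: Q0)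
  then have "\<forall>\<^sub>F z in nhds 0. Re (Q z) > 0"
    by (rule order_tendstoD) simp
  ultimately have "\<forall>\<^sub>F z in nhds 0. f z \<noteq> 0 \<and> Re (Q z) > 0"
    by (rule eventually_conj)
  then obtain \<rho>0 where r0: "\<rho>0 > 0" "\<And>z. z \<in> ball 0 \<rho>0 \<Longrightarrow> f z \<noteq> 0 \<and> Re (Q z) > 0"
    unfolding eventually_nhds_metric by (auto simp: dist_commute)
  define E where "E = (\<lambda>z. Ln (Q z))"
  have "Q holomorphic_on ball 0 \<rho>0"
    unfolding Q_def using r0(2)
    by (intro holomorphic_intros holomorphic_on_subset[OF U_hol] holomorphic_on_subset[OF f_hol]) auto
  then have E_hol: "E holomorphic_on ball 0 \<rho>0"
    unfolding E_def
    by (intro holomorphic_intros) (use r0(2) in \<open>force simp: complex_nonpos_Reals_iff\<close>)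
  have "deriv E holomorphic_on ball 0 \<rho>0"
    by (intro holomorphic_deriv E_hol) auto
  then have "isCont (\<lambda>z. cmod (z * deriv E z)) 0"
    using r0(1) by (intro continuous_intros) (metis holomorphic_on_imp_continuous_on
      continuous_on_eq_continuous_at open_ball centre_in_ball)
  then have "((\<lambda>z. cmod (z * deriv E z)) \<longlongrightarrow> 0) (nhds 0)"
    using tendsto_at_iff_tendsto_nhds[of "\<lambda>z. cmod (z * deriv E z)" 0] by (simp add: isCont_def)
  then have "\<forall>\<^sub>F z in nhds 0. cmod (z * deriv E z) < 1"
    by (rule order_tendstoD) simp
  then obtain \<rho>1 where r1: "\<rho>1 > 0" "\<And>z. z \<in> ball 0 \<rho>1 \<Longrightarrow> cmod (z * deriv E z) < 1"
    unfolding eventually_nhds_metric by (auto simp: dist_commute)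
  show ?thesis
  proof (rule that[of "min \<rho>0 \<rho>1" E])
    show "E holomorphic_on ball 0 (min \<rho>0 \<rho>1)"
      by (rule holomorphic_on_subset[OF E_hol]) auto
    show "E 0 = 0"
      by (simp add: E_def Q0)
    fix z :: complex assume "z \<in> ball 0 (min \<rho>0 \<rho>1)"
    then have z: "f z \<noteq> 0" "Re (Q z) > 0" "cmod (z * deriv E z) < 1"
      using r0(2) r1(2) by auto
    then have "Q z \<noteq> 0"
      by auto
    show "f z \<noteq> 0" "cmod (z * deriv E z) < 1"
      by fact+
    show "\<bar>Im (E z)\<bar> < pi / 2"
      unfolding E_def using z(2) Re_Ln_pos_lt[OF \<open>Q z \<noteq> 0\<close>] by simp
    have "f z * exp (E z) = U z"
      using \<open>Q z \<noteq> 0\<close> z(1) by (simp add: E_def Q_def)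
    then show "z * deriv f z = f z * (of_nat k * a * z ^ k * exp (E z))"
      unfolding zf' by (metis mult.assoc mult.left_commute)
  qed (use r0 r1 in auto)
qed

lemma has_vector_derivative_along_circle:
  assumes "(F has_field_derivative F') (at (rcis r \<theta>))"
  shows "((\<lambda>t. F (rcis r t)) has_vector_derivative \<i> * rcis r \<theta> * F') (at \<theta>)"
proof -
  have "((\<lambda>z. of_real r * exp (\<i> * z)) has_field_derivative \<i> * rcis r \<theta>) (at (of_real \<theta>))"
    by (auto intro!: derivative_eq_intros simp: rcis_def cis_conv_exp)
  then have "((\<lambda>t. of_real r * exp (\<i> * of_real t)) has_vector_derivative \<i> * rcis r \<theta>) (at \<theta>)"
    using field_vector_diff_chain_at[OF has_vector_derivative_of_real[OF DERIV_ident]]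
    by (fastforce simp: o_def)
  then have "(rcis r has_vector_derivative \<i> * rcis r \<theta>) (at \<theta>)"
    by (simp add: rcis_def[abs_def] cis_conv_exp)
  from field_vector_diff_chain_at[OF this assms] show ?thesis
    by (simp add: o_def)
qed

text \<open>
  The conclusions of the normal form, together with the chosen argument of \<open>a\<close>, are all that the
  study of \<open>\<bar>f\<bar>\<close> on small circles depends on.
\<close>

locale angular_normal_form =
  fixes f E :: "complex \<Rightarrow> complex" and a :: complex and k :: nat and \<alpha> \<rho> :: real
  assumes f_hol: "f holomorphic_on ball 0 \<rho>"
    and E_hol: "E holomorphic_on ball 0 \<rho>"
    and k_pos: "k \<ge> 1" and a_nz: "a \<noteq> 0" and a_arg: "is_Arg a \<alpha>"
    and f_nz: "\<And>z. z \<in> ball 0 \<rho> \<Longrightarrow> f z \<noteq> 0"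
    and log_deriv: "\<And>z. z \<in> ball 0 \<rho> \<Longrightarrow>
      z * deriv f z = f z * (of_nat k * a * z ^ k * exp (E z))"
    and E_0: "E 0 = 0"
    and E_Im: "\<And>z. z \<in> ball 0 \<rho> \<Longrightarrow> \<bar>Im (E z)\<bar> < pi / 2"
    and E_deriv: "\<And>z. z \<in> ball 0 \<rho> \<Longrightarrow> cmod (z * deriv E z) < 1"
begin

text \<open>
  The argument of \<open>z f'(z) / f(z)\<close> at \<open>z = r e\<^sup>i\<^sup>\<theta>\<close>, as a continuous real function of \<open>\<theta>\<close>.
\<close>

definition phase :: "real \<Rightarrow> real \<Rightarrow> real" where
  "phase r \<theta> = real k * \<theta> + \<alpha> + Im (E (rcis r \<theta>))"

lemma rcis_in_ball: "0 < r \<Longrightarrow> r < \<rho> \<Longrightarrow> rcis r \<theta> \<in> ball 0 \<rho>"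
  by simp

lemma phase_has_derivative:
  assumes r: "0 < r" "r < \<rho>"
  shows "(phase r has_real_derivative
    real k + Im (\<i> * rcis r \<theta> * deriv E (rcis r \<theta>))) (at \<theta>)"
proof -
  have "(E has_field_derivative deriv E (rcis r \<theta>)) (at (rcis r \<theta>))"
    using E_hol rcis_in_ball[OF r] by (intro holomorphic_derivI[of _ "ball 0 \<rho>"]) auto
  from has_vector_derivative_along_circle[OF this]
  have "((\<lambda>t. Im (E (rcis r t))) has_real_derivative
      Im (\<i> * rcis r \<theta> * deriv E (rcis r \<theta>))) (at \<theta>)"
    unfolding has_real_derivative_iff_has_vector_derivative
    by (rule bounded_linear.has_vector_derivative[OF bounded_linear_Im])
  moreover have "((\<lambda>t. real k * t + \<alpha>) has_real_derivative real k) (at \<theta>)"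
    by (auto intro!: derivative_eq_intros)
  ultimately show ?thesis
    unfolding phase_def[abs_def] by (rule DERIV_add[rotated])
qed

text \<open>
  The derivative is \<open>k + Re (z E'(z))\<close>, which is positive because \<open>k \<ge> 1 > \<bar>z E'(z)\<bar>\<close>.
\<close>

lemma phase_strict_mono:
  assumes r: "0 < r" "r < \<rho>" and "\<theta>\<^sub>1 < \<theta>\<^sub>2"
  shows "phase r \<theta>\<^sub>1 < phase r \<theta>\<^sub>2"
proof (rule DERIV_pos_imp_increasing[OF \<open>\<theta>\<^sub>1 < \<theta>\<^sub>2\<close>])
  fix \<theta>
  define w where "w = rcis r \<theta> * deriv E (rcis r \<theta>)"
  have "cmod w < 1"
    unfolding w_def using E_deriv rcis_in_ball[OF r] by blast
  moreover have "\<bar>Im (\<i> * w)\<bar> \<le> cmod w"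
    using abs_Im_le_cmod[of "\<i> * w"] by (simp add: norm_mult)
  ultimately have "real k + Im (\<i> * w) > 0"
    using k_pos by linarith
  then show "\<exists>y. (phase r has_real_derivative y) (at \<theta>) \<and> 0 < y"
    using phase_has_derivative[OF r, of \<theta>] by (auto simp: w_def mult.assoc)
qed

lemma phase_inj:
  assumes r: "0 < r" "r < \<rho>" and "phase r \<theta>\<^sub>1 = phase r \<theta>\<^sub>2"
  shows "\<theta>\<^sub>1 = \<theta>\<^sub>2"
  using phase_strict_mono[OF r, of \<theta>\<^sub>1 \<theta>\<^sub>2] phase_strict_mono[OF r, of \<theta>\<^sub>2 \<theta>\<^sub>1] assms(3)
  by (cases \<theta>\<^sub>1 \<theta>\<^sub>2 rule: linorder_cases) auto

text \<open>
  The derivative is \<open>2 Re (cnj f \<cdot> i z f') = - 2 \<bar>f\<bar>\<^sup>2 Im (z f' / f)\<close>, and the phase is the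
  argument of \<open>z f' / f\<close>.
\<close>

lemma norm_square_has_derivative:
  assumes r: "0 < r" "r < \<rho>"
  obtains C where "C > 0" "((\<lambda>t. (cmod (f (rcis r t)))\<^sup>2) has_real_derivative
    - C * sin (phase r \<theta>)) (at \<theta>)"
proof -
  define z where "z = rcis r \<theta>"
  have z: "z \<in> ball 0 \<rho>"
    unfolding z_def by (rule rcis_in_ball[OF r])
  define K where "K = (cmod (f z))\<^sup>2 * (real k * cmod a * r ^ k * exp (Re (E z)))"
  have "K > 0"
    unfolding K_def using f_nz[OF z] k_pos a_nz r by simp
  have a: "a = of_real (cmod a) * cis \<alpha>"
    using a_arg by (simp add: is_Arg_def cis_conv_exp)
  have "(f has_field_derivative deriv f z) (at z)"
    using f_hol z by (intro holomorphic_derivI[of _ "ball 0 \<rho>"]) auto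
  from has_vector_derivative_along_circle[OF this[unfolded z_def]]
  have F: "((\<lambda>t. f (rcis r t)) has_vector_derivative \<i> * z * deriv f z) (at \<theta>)"
    by (simp add: z_def)
  have der: "((\<lambda>t. (cmod (f (rcis r t)))\<^sup>2) has_real_derivative
      2 * Re (cnj (f z) * (\<i> * z * deriv f z))) (at \<theta>)"
  proof -
    have Re: "((\<lambda>t. Re (f (rcis r t))) has_real_derivative Re (\<i> * z * deriv f z)) (at \<theta>)"
      and Im: "((\<lambda>t. Im (f (rcis r t))) has_real_derivative Im (\<i> * z * deriv f z)) (at \<theta>)"
      unfolding has_real_derivative_iff_has_vector_derivative
      by (rule bounded_linear.has_vector_derivative[OF bounded_linear_Re F]
          bounded_linear.has_vector_derivative[OF bounded_linear_Im F])+
    show ?thesis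
      unfolding cmod_power2
      by (rule derivative_eq_intros Re Im refl)+ (simp add: z_def algebra_simps)
  qed
  have zk: "z ^ k = of_real (r ^ k) * cis (real k * \<theta>)"
    by (simp add: z_def rcis_def power_mult_distrib Complex.DeMoivre)
  have "cnj (f z) * (\<i> * z * deriv f z) = \<i> * (cnj (f z) * f z) * (of_nat k * a * z ^ k * exp (E z))"
    using log_deriv[OF z] by (simp add: mult.assoc)
  also have "cnj (f z) * f z = of_real ((cmod (f z))\<^sup>2)"
    by (simp only: complex_norm_square mult.commute)
  also have "\<i> * of_real ((cmod (f z))\<^sup>2) * (of_nat k * a * z ^ k * exp (E z)) =
      of_real K * (\<i> * (cis \<alpha> * cis (real k * \<theta>) * cis (Im (E z))))"
    by (subst a) (simp add: K_def zk exp_eq_polar mult_ac)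
  also have "cis \<alpha> * cis (real k * \<theta>) * cis (Im (E z)) = cis (phase r \<theta>)"
    by (simp add: cis_mult phase_def z_def add_ac)
  finally have "2 * Re (cnj (f z) * (\<i> * z * deriv f z)) = - (2 * K) * sin (phase r \<theta>)"
    by (simp only:) simp
  with der have "((\<lambda>t. (cmod (f (rcis r t)))\<^sup>2) has_real_derivative
      - (2 * K) * sin (phase r \<theta>)) (at \<theta>)"
    by (simp only:)
  then show ?thesis
    using \<open>K > 0\<close> by (intro that[of "2 * K"]) simp_all
qed

text \<open>
  If \<open>\<theta> < t\<close>, the phase lies in \<open>(2 \<pi> j - \<pi>, 2 \<pi> j)\<close> strictly between the two angles, so the sine
  is negative there and the modulus increases; if \<open>t < \<theta>\<close>, the signs are reversed.
\<close>

lemma norm_less_at_critical_angle: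
  assumes r: "0 < r" "r < \<rho>" and t: "phase r t = 2 * pi * of_int j"
    and near: "\<bar>phase r \<theta> - 2 * pi * of_int j\<bar> \<le> pi" and "\<theta> \<noteq> t"
  shows "cmod (f (rcis r \<theta>)) < cmod (f (rcis r t))"
proof -
  have sin_shift: "sin (x - 2 * pi * of_int j) = sin x" for x
    by (simp add: sin_diff)
  define n where "n = (\<lambda>t. (cmod (f (rcis r t)))\<^sup>2)"
  have cont: "continuous_on S n" for S
  proof (intro continuous_at_imp_continuous_on ballI)
    fix x
    obtain C where "(n has_real_derivative - C * sin (phase r x)) (at x)"
      unfolding n_def by (rule norm_square_has_derivative[OF r])
    then show "isCont n x"
      by (rule DERIV_isCont)
  qed
  have "n \<theta> < n t"
  proof (cases "\<theta> < t")
    case True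
    show ?thesis
    proof (rule DERIV_pos_imp_increasing_open[OF True _ cont])
      fix x assume x: "\<theta> < x" "x < t"
      have "- pi < phase r x - 2 * pi * of_int j" "phase r x - 2 * pi * of_int j < 0"
        using phase_strict_mono[OF r x(1)] phase_strict_mono[OF r x(2)] near t by linarith+
      then have "sin (phase r x) < 0"
        using sin_gt_zero[of "- (phase r x - 2 * pi * of_int j)"] sin_shift[of "phase r x"]
        by (simp only: sin_minus) simp
      obtain C where "C > 0" "(n has_real_derivative - C * sin (phase r x)) (at x)"
        unfolding n_def by (rule norm_square_has_derivative[OF r])
      with \<open>sin (phase r x) < 0\<close> show "\<exists>y. (n has_real_derivative y) (at x) \<and> y > 0"
        by (intro exI[of _ "- C * sin (phase r x)"]) (simp add: mult_pos_neg)
    qed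
  next
    case False
    then have "t < \<theta>"
      using \<open>\<theta> \<noteq> t\<close> by simp
    show ?thesis
    proof (rule DERIV_neg_imp_decreasing_open[OF \<open>t < \<theta>\<close> _ cont])
      fix x assume x: "t < x" "x < \<theta>"
      have "0 < phase r x - 2 * pi * of_int j" "phase r x - 2 * pi * of_int j < pi"
        using phase_strict_mono[OF r x(1)] phase_strict_mono[OF r x(2)] near t by linarith+
      then have "sin (phase r x) > 0"
        using sin_gt_zero[of "phase r x - 2 * pi * of_int j"] sin_shift[of "phase r x"] by simp
      obtain C where "C > 0" "(n has_real_derivative - C * sin (phase r x)) (at x)"
        unfolding n_def by (rule norm_square_has_derivative[OF r])
      with \<open>sin (phase r x) > 0\<close> show "\<exists>y. (n has_real_derivative y) (at x) \<and> y < 0"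
        by (intro exI[of _ "- C * sin (phase r x)"]) simp
    qed
  qed
  then show ?thesis
    unfolding n_def by (rule power_less_imp_less_base) simp
qed

end

section \<open>Maximum modulus sets and rotations\<close>

lemma in_max_modulus_set_iff:
  assumes "continuous_on (sphere 0 (cmod z)) f"
  shows "z \<in> max_modulus_set f \<longleftrightarrow> (\<forall>w. cmod w = cmod z \<longrightarrow> cmod (f w) \<le> cmod (f z))"
proof -
  let ?S = "sphere (0::complex) (cmod z)"
  have "compact ((\<lambda>w. cmod (f w)) ` ?S)"
    by (intro compact_continuous_image continuous_intros assms) simp
  then have bdd: "bdd_above ((\<lambda>w. cmod (f w)) ` ?S)"
    by (intro bounded_imp_bdd_above compact_imp_bounded)
  show ?thesis
  proof
    assume "z \<in> max_modulus_set f"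
    then show "\<forall>w. cmod w = cmod z \<longrightarrow> cmod (f w) \<le> cmod (f z)"
      using cSUP_upper[OF _ bdd] by (auto simp: max_modulus_set_def max_modulus_def)
  next
    assume "\<forall>w. cmod w = cmod z \<longrightarrow> cmod (f w) \<le> cmod (f z)"
    then have "(SUP w\<in>?S. cmod (f w)) = cmod (f z)"
      by (intro cSup_eq_maximum) auto
    then show "z \<in> max_modulus_set f"
      by (simp add: max_modulus_set_def max_modulus_def)
  qed
qed

lemma is_Arg_iff_rcis: "is_Arg z \<theta> \<longleftrightarrow> z = rcis (cmod z) \<theta>"
  by (simp add: is_Arg_def rcis_def cis_conv_exp)

lemma rotate_sector:
  "(\<lambda>z. cis \<beta> * z) ` sector \<omega> r \<phi> = sector (\<omega> + \<beta>) r \<phi>"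
proof -
  have *: "cis \<beta> * z \<in> sector (\<omega> + \<beta>) r \<phi>" if "z \<in> sector \<omega> r \<phi>" for z \<beta> \<omega>
  proof -
    from that obtain \<theta> where t: "is_Arg z \<theta>" "\<bar>\<theta> - \<omega>\<bar> < \<phi>"
      by (auto simp: sector_def)
    have "is_Arg (cis \<beta> * z) (\<theta> + \<beta>)"
    proof -
      define s where "s = cmod z"
      have z: "z = rcis s \<theta>"
        using t(1) by (simp only: is_Arg_iff_rcis s_def)
      have "cmod (cis \<beta> * z) = s"
        by (simp add: s_def norm_mult)
      moreover have "cis \<beta> * z = rcis s (\<theta> + \<beta>)"
        unfolding z by (simp add: rcis_def cis_mult mult.left_commute add.commute)
      ultimately show ?thesis
        unfolding is_Arg_iff_rcis by simp
    qed
    with t(2) that show ?thesis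
      by (auto simp: sector_def norm_mult intro!: exI[of _ "\<theta> + \<beta>"])
  qed
  have "z \<in> (\<lambda>z. cis \<beta> * z) ` sector \<omega> r \<phi>" if "z \<in> sector (\<omega> + \<beta>) r \<phi>" for z
  proof (rule image_eqI)
    show "z = cis \<beta> * (cis (- \<beta>) * z)"
      by (simp add: mult.assoc[symmetric] cis_mult)
    show "cis (- \<beta>) * z \<in> sector \<omega> r \<phi>"
      using *[OF that, of "- \<beta>"] by simp
  qed
  with * show ?thesis
    by blast
qed

lemma rotate_max_modulus_set_on:
  assumes inv: "\<And>z. f (c * z) = f z" and c: "cmod c = 1"
  shows "max_modulus_set_on f ((\<lambda>z. c * z) ` T) = (\<lambda>z. c * z) ` max_modulus_set_on f T"
  unfolding max_modulus_set_on_def by (auto simp: inv norm_mult c)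

text \<open>
  Euclidean division by the period \<open>d\<close> identifies \<open>J\<close> with the product of \<open>J \<inter> {..<d}\<close> and
  \<open>{..<\<mu>}\<close>.
\<close>

lemma dvd_card_of_periodic:
  fixes J :: "nat set"
  assumes J: "J \<subseteq> {..<\<mu> * d}" and per: "\<And>i m. i < d \<Longrightarrow> m < \<mu> \<Longrightarrow> i + m * d \<in> J \<longleftrightarrow> i \<in> J"
  shows "\<mu> dvd card J"
proof -
  let ?h = "\<lambda>(i, m). i + m * d"
  have "bij_betw ?h ((J \<inter> {..<d}) \<times> {..<\<mu>}) J"
  proof (rule bij_betw_byWitness[where f' = "\<lambda>j. (j mod d, j div d)"])
    show "\<forall>x\<in>(J \<inter> {..<d}) \<times> {..<\<mu>}. ((?h x) mod d, (?h x) div d) = x"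
      by auto
    show "\<forall>j\<in>J. ?h (j mod d, j div d) = j"
      by simp
    show "?h ` ((J \<inter> {..<d}) \<times> {..<\<mu>}) \<subseteq> J"
      using per by auto
    show "(\<lambda>j. (j mod d, j div d)) ` J \<subseteq> (J \<inter> {..<d}) \<times> {..<\<mu>}"
    proof (rule image_subsetI)
      fix j assume j: "j \<in> J"
      then have lt: "j < \<mu> * d"
        using J by blast
      then have "0 < d"
        by (cases d) auto
      then have "j mod d < d" "j div d < \<mu>"
        using lt by (auto simp: less_mult_imp_div_less)
      moreover from this have "j mod d \<in> J"
        using per[of "j mod d" "j div d"] j by simp
      ultimately show "(j mod d, j div d) \<in> (J \<inter> {..<d}) \<times> {..<\<mu>}"
        by simp
    qed
  qed
  then have "card J = card (J \<inter> {..<d}) * \<mu>"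
    by (simp add: bij_betw_same_card[symmetric] card_cartesian_product)
  then show ?thesis
    by simp
qed

section \<open>The inner degree\<close>

text \<open>
  A function of \<open>z\<^sup>m\<close> is invariant under multiplication of \<open>z\<close> by a primitive \<open>m\<close>-th root of unity
  \<open>\<zeta>\<close>. Comparing the coefficients of \<open>z\<^sup>k\<close> gives \<open>a \<zeta>\<^sup>k = a\<close>, hence \<open>\<zeta>\<^sup>k = 1\<close>.
\<close>

lemma exponent_dvd_first_order:
  fixes f g h :: "complex \<Rightarrow> complex"
  assumes f: "\<And>z. f z = 1 + a * z ^ k + z ^ (k + 1) * h z" and h: "h holomorphic_on UNIV"
    and a: "a \<noteq> 0" and g: "\<And>z. f z = g (z ^ m)" and m: "m \<ge> 1"
  shows "m dvd k"
proof -
  define \<zeta> :: complex where "\<zeta> = exp (2 * of_real pi * \<i> * of_nat 1 / of_nat m)"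
  have "\<zeta> ^ m = 1"
    unfolding \<zeta>_def using m complex_root_unity[of m 1] by simp
  then have inv: "f (\<zeta> * z) = f z" for z
    by (simp add: g power_mult_distrib)
  have eq: "a * \<zeta> ^ k + z * (\<zeta> ^ (k + 1) * h (\<zeta> * z)) = a + z * h z" if "z \<noteq> 0" for z
  proof -
    have "z ^ k * (a * \<zeta> ^ k + z * (\<zeta> ^ (k + 1) * h (\<zeta> * z))) = f (\<zeta> * z) - 1"
      by (simp add: f power_mult_distrib algebra_simps)
    also have "\<dots> = z ^ k * (a + z * h z)"
      unfolding inv by (simp add: f algebra_simps)
    finally show ?thesis
      using that by simp
  qed
  have h_cont: "isCont h z" for z
    using h holomorphic_on_imp_continuous_on continuous_on_eq_continuous_at by blast
  have "isCont (\<lambda>z. h (\<zeta> * z)) 0"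
    by (rule isCont_o2[of _ "\<lambda>z. \<zeta> * z" h]) (auto intro!: continuous_intros h_cont)
  then have "isCont (\<lambda>z. a * \<zeta> ^ k + z * (\<zeta> ^ (k + 1) * h (\<zeta> * z))) 0"
    by (intro continuous_intros)
  then have "((\<lambda>z. a * \<zeta> ^ k + z * (\<zeta> ^ (k + 1) * h (\<zeta> * z))) \<longlongrightarrow> a * \<zeta> ^ k) (at 0)"
    by (simp add: isCont_def)
  moreover have "isCont (\<lambda>z. a + z * h z) 0"
    by (intro continuous_intros h_cont)
  then have "((\<lambda>z. a + z * h z) \<longlongrightarrow> a) (at 0)"
    by (simp add: isCont_def)
  then have "((\<lambda>z. a * \<zeta> ^ k + z * (\<zeta> ^ (k + 1) * h (\<zeta> * z))) \<longlongrightarrow> a) (at 0)"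
    by (rule Lim_transform_eventually)
      (unfold eventually_at_filter, intro always_eventually allI impI eq[symmetric])
  ultimately have "a * \<zeta> ^ k = a"
    by (rule LIM_unique)
  then have "\<zeta> ^ k = 1"
    using a by simp
  moreover have "\<zeta> ^ k = exp (2 * of_real pi * \<i> * of_nat k / of_nat m)"
    unfolding \<zeta>_def exp_of_nat_mult[symmetric] by (simp add: mult_ac)
  ultimately show "m dvd k"
    using complex_root_unity_eq_1[OF m, of k] by simp
qed

text \<open>
  Since every admissible exponent divides \<open>k\<close>, the admissible exponents are bounded by \<open>k\<close>, so the
  greatest one exists and is itself admissible.
\<close>

lemma inner_degree_properties:
  fixes f h :: "complex \<Rightarrow> complex"
  assumes f: "\<And>z. f z = 1 + a * z ^ k + z ^ (k + 1) * h z" and h: "h holomorphic_on UNIV"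
    and a: "a \<noteq> 0" and k: "k \<ge> 1"
  shows "inner_degree f \<ge> 1" and "inner_degree f dvd k"
    and "f (cis (2 * pi * real m / real (inner_degree f)) * z) = f z"
proof -
  define P where "P = (\<lambda>m. m \<ge> 1 \<and> (\<exists>g. g holomorphic_on UNIV \<and> (\<forall>z. f z = g (z ^ m))))"
  have f_hol: "f holomorphic_on UNIV"
    unfolding f[THEN ext, of "\<lambda>z. z", simplified] by (intro holomorphic_intros h)
  have "P 1"
    unfolding P_def using f_hol by auto
  moreover have dvd: "m dvd k" if "P m" for m
    using that exponent_dvd_first_order[OF f h a] unfolding P_def by blast
  have "m \<le> k" if "P m" for m
    using dvd[OF that] k by (intro dvd_imp_le) auto
  ultimately have "P (Greatest P)"
    by (rule GreatestI_nat)
  then have P: "P (inner_degree f)"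
    by (simp only: inner_degree_def P_def)
  then show "inner_degree f \<ge> 1" "inner_degree f dvd k"
    using dvd by (auto simp: P_def)
  from P obtain g where g: "\<And>z. f z = g (z ^ inner_degree f)"
    by (auto simp: P_def)
  have "cis (2 * pi * real m / real (inner_degree f)) ^ inner_degree f = 1"
    using \<open>inner_degree f \<ge> 1\<close> by (simp add: Complex.DeMoivre)
  then show "f (cis (2 * pi * real m / real (inner_degree f)) * z) = f z"
    by (simp add: g power_mult_distrib)
qed

section \<open>The curves of local maxima\<close>

text \<open>
  The curves \<open>g j\<close> solve the equation \<open>phase = 2 \<pi> j\<close>, here in the form of a prescribed argument. The
  assumption \<open>rank\<close> says that \<open>R\<close> is so small that the order of the values of \<open>\<bar>f\<bar>\<close> on the curves
  no longer depends on the radius.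
\<close>

locale critical_curves = angular_normal_form +
  fixes g :: "nat \<Rightarrow> complex \<Rightarrow> complex" and R \<delta> :: real
  assumes R: "0 < R" "R < \<delta>"
    and g_hol: "\<And>j. j < k \<Longrightarrow> g j holomorphic_on ball 0 \<delta>"
    and g_inj: "\<And>j. j < k \<Longrightarrow> inj_on (g j) (ball 0 \<delta>)"
    and g_ball: "\<And>j r. j < k \<Longrightarrow> 0 < r \<Longrightarrow> r \<le> R \<Longrightarrow> g j (of_real r) \<in> ball 0 \<rho>"
    and g_polar: "\<And>j r. j < k \<Longrightarrow> 0 < r \<Longrightarrow> r \<le> R \<Longrightarrow>
      g j (of_real r) = rcis r (ray_angle k \<alpha> j - Im (E (g j (of_real r))) / real k)"
    and rank: "\<And>i j r. i < k \<Longrightarrow> j < k \<Longrightarrow> 0 < r \<Longrightarrow> r \<le> R \<Longrightarrow>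
      cmod (f (g i (of_real r))) \<le> cmod (f (g j (of_real r))) \<longleftrightarrow>
      cmod (f (g i (of_real R))) \<le> cmod (f (g j (of_real R)))"
begin

abbreviation \<omega> :: "nat \<Rightarrow> real" where "\<omega> \<equiv> ray_angle k \<alpha>"

text \<open>
  On the curve with index \<open>j\<close> this is the argument of \<open>z\<close> that is close to \<open>\<omega> j\<close>.
\<close>

definition angle :: "nat \<Rightarrow> complex \<Rightarrow> real" where
  "angle j z = \<omega> j - Im (E z) / real k"

definition curve :: "nat \<Rightarrow> complex set" where
  "curve j = g j ` complex_of_real ` {0<..R}"

text \<open>
  In a sector of this half-angle \<open>k \<theta>\<close> deviates from \<open>k \<omega>\<^sub>j\<close> by less than \<open>\<pi> / 2\<close>. As
  \<open>\<bar>Im (E z)\<bar> < \<pi> / 2\<close>, the phase stays within \<open>\<pi>\<close> of \<open>2 \<pi> j\<close>, and the sector also contains the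
  curve.
\<close>

definition half_angle :: real where "half_angle = pi / (2 * real k)"

definition winners :: "nat set" where
  "winners = {j. j < k \<and> (\<forall>i<k. cmod (f (g i (of_real R))) \<le> cmod (f (g j (of_real R))))}"

lemma k_angle: "real k * \<omega> j + \<alpha> = 2 * pi * real j"
  using k_pos by (simp add: ray_angle_def)

lemma half_angle_pos: "half_angle > 0"
  using k_pos by (simp add: half_angle_def)

lemma cmod_g: "j < k \<Longrightarrow> 0 < r \<Longrightarrow> r \<le> R \<Longrightarrow> cmod (g j (of_real r)) = r"
  by (subst g_polar) auto

lemma g_eq_rcis: "j < k \<Longrightarrow> 0 < r \<Longrightarrow> r \<le> R \<Longrightarrow>
    g j (of_real r) = rcis r (angle j (g j (of_real r)))"
  unfolding angle_def by (rule g_polar)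

lemma R_less: "R < \<rho>"
  using g_ball[of 0 R] cmod_g[of 0 R] k_pos R by auto

lemma phase_g:
  assumes "j < k" "0 < r" "r \<le> R"
  shows "phase r (angle j (g j (of_real r))) = 2 * pi * of_int (int j)"
proof -
  define w where "w = g j (of_real r)"
  have "real k * angle j w = real k * \<omega> j - Im (E w)"
    using k_pos by (simp add: angle_def right_diff_distrib)
  moreover have "rcis r (angle j w) = w"
    unfolding w_def by (rule g_eq_rcis[OF assms, symmetric])
  ultimately show ?thesis
    using k_angle[of j] unfolding phase_def w_def[symmetric] by simp
qed

lemma g_maximal:
  assumes j: "j < k" and r: "0 < r" "r \<le> R"
    and near: "\<bar>phase r \<theta> - 2 * pi * real j\<bar> \<le> pi" and "rcis r \<theta> \<noteq> g j (of_real r)"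
  shows "cmod (f (rcis r \<theta>)) < cmod (f (g j (of_real r)))"
proof -
  define t where "t = angle j (g j (of_real r))"
  have g: "g j (of_real r) = rcis r t"
    unfolding t_def by (rule g_eq_rcis[OF j r])
  have "phase r t = 2 * pi * of_int (int j)"
    unfolding t_def by (rule phase_g[OF j r])
  moreover have "\<theta> \<noteq> t"
    using assms(5) g by auto
  ultimately show ?thesis
    unfolding g using r R_less near by (intro norm_less_at_critical_angle[of r t "int j"]) auto
qed

lemma sector_maximal:
  assumes j: "j < k" and z: "z \<in> sector (\<omega> j) R half_angle" and "z \<noteq> g j (of_real (cmod z))"
  shows "cmod (f z) < cmod (f (g j (of_real (cmod z))))"
proof -
  define r where "r = cmod z"
  from z obtain \<theta> where t: "z = rcis r \<theta>" "\<bar>\<theta> - \<omega> j\<bar> < half_angle" and r: "0 < r" "r \<le> R"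
    by (auto simp: sector_def is_Arg_iff_rcis r_def)
  have "phase r \<theta> - 2 * pi * real j = real k * (\<theta> - \<omega> j) + Im (E z)"
    unfolding phase_def k_angle[symmetric] t(1)[symmetric] by (simp add: algebra_simps)
  moreover have "\<bar>real k * (\<theta> - \<omega> j)\<bar> < pi / 2"
  proof -
    have "real k * \<bar>\<theta> - \<omega> j\<bar> < real k * half_angle"
      using t(2) k_pos by simp
    also have "\<dots> = pi / 2"
      using k_pos by (simp add: half_angle_def)
    finally show ?thesis
      by (simp add: abs_mult)
  qed
  moreover have "\<bar>Im (E z)\<bar> < pi / 2"
    using r R_less by (intro E_Im) (simp add: r_def)
  ultimately have "\<bar>phase r \<theta> - 2 * pi * real j\<bar> \<le> pi"
    by linarith
  then show ?thesis
    using g_maximal[OF j r] t(1) assms(3) unfolding r_def by metis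
qed

lemma g_in_sector:
  assumes "j < k" "0 < r" "r \<le> R"
  shows "g j (of_real r) \<in> sector (\<omega> j) R half_angle"
proof -
  have "is_Arg (g j (of_real r)) (angle j (g j (of_real r)))"
    unfolding is_Arg_iff_rcis cmod_g[OF assms] by (rule g_eq_rcis[OF assms])
  moreover have "\<bar>angle j (g j (of_real r)) - \<omega> j\<bar> < half_angle"
    using E_Im[OF g_ball[OF assms]] k_pos by (simp add: angle_def half_angle_def field_simps)
  ultimately show ?thesis
    using cmod_g[OF assms] assms by (auto simp: sector_def)
qed

lemma mem_curve_iff:
  assumes "j < k"
  shows "z \<in> curve j \<longleftrightarrow> 0 < cmod z \<and> cmod z \<le> R \<and> z = g j (of_real (cmod z))"
proof
  assume "z \<in> curve j"
  then obtain r where r: "0 < r" "r \<le> R" "z = g j (of_real r)"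
    by (auto simp: curve_def)
  then have "cmod z = r"
    using cmod_g[OF assms] by simp
  with r show "0 < cmod z \<and> cmod z \<le> R \<and> z = g j (of_real (cmod z))"
    by simp
next
  assume "0 < cmod z \<and> cmod z \<le> R \<and> z = g j (of_real (cmod z))"
  then show "z \<in> curve j"
    unfolding curve_def by (intro image_eqI[of _ _ "of_real (cmod z)"]) auto
qed

lemma curve_eq_max_modulus_set_on:
  assumes j: "j < k"
  shows "curve j = max_modulus_set_on f (sector (\<omega> j) R half_angle)"
proof (intro set_eqI iffI)
  fix z assume "z \<in> curve j"
  then have z: "0 < cmod z" "cmod z \<le> R" "z = g j (of_real (cmod z))"
    using mem_curve_iff[OF j] by auto
  have "z \<in> sector (\<omega> j) R half_angle"
    using g_in_sector[OF j z(1,2)] z(3) by simp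
  moreover have "cmod (f w) \<le> cmod (f z)"
    if "w \<in> sector (\<omega> j) R half_angle" "cmod w = cmod z" for w
    using sector_maximal[OF j that(1)] that(2) z(3) by (metis less_eq_real_def)
  ultimately show "z \<in> max_modulus_set_on f (sector (\<omega> j) R half_angle)"
    by (simp add: max_modulus_set_on_def)
next
  fix z assume "z \<in> max_modulus_set_on f (sector (\<omega> j) R half_angle)"
  then have z: "z \<in> sector (\<omega> j) R half_angle"
    and max: "\<And>w. w \<in> sector (\<omega> j) R half_angle \<Longrightarrow> cmod w = cmod z \<Longrightarrow> cmod (f w) \<le> cmod (f z)"
    by (auto simp: max_modulus_set_on_def)
  from z have r: "0 < cmod z" "cmod z \<le> R"
    by (auto simp: sector_def)
  have "z = g j (of_real (cmod z))"
    using sector_maximal[OF j z] max[OF g_in_sector[OF j r]] cmod_g[OF j r] by fastforce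
  with r show "z \<in> curve j"
    using mem_curve_iff[OF j] by blast
qed

text \<open>
  Every real number is within \<open>\<pi>\<close> of a multiple \<open>2 \<pi> n\<close>, so every point of the circle competes with
  the critical point of some integer index \<open>n\<close>. Adding \<open>2 \<pi>\<close> to the angle adds \<open>2 \<pi> k\<close> to the phase,
  which allows the index to be reduced modulo \<open>k\<close>.
\<close>

lemma circle_maximal:
  assumes r: "0 < cmod z" "cmod z \<le> R"
  obtains j where "j < k" "z = g j (of_real (cmod z)) \<or> cmod (f z) < cmod (f (g j (of_real (cmod z))))"
proof -
  define r where "r = cmod z"
  define \<theta> where "\<theta> = Arg z"
  have z: "z = rcis r \<theta>"
    unfolding r_def \<theta>_def by (simp add: rcis_cmod_Arg)
  define n where "n = round (phase r \<theta> / (2 * pi))"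
  have "\<bar>of_int n - phase r \<theta> / (2 * pi)\<bar> \<le> 1 / 2"
    unfolding n_def by (rule of_int_round_abs_le)
  then have "\<bar>phase r \<theta> - 2 * pi * of_int n\<bar> \<le> pi"
    by (simp add: abs_le_iff field_simps)
  moreover define j where "j = nat (n mod int k)"
  define q where "q = n div int k"
  have j: "j < k" and n: "n = int j + int k * q"
    using k_pos by (simp_all add: j_def q_def nat_less_iff)
  have z': "z = rcis r (\<theta> - 2 * pi * of_int q)"
    unfolding z by (simp add: rcis_def cis.ctr complex_eq_iff sin_diff cos_diff)
  have "phase r (\<theta> - 2 * pi * of_int q) = phase r \<theta> - 2 * pi * (real k * of_int q)"
    unfolding phase_def z'[symmetric] z[symmetric] by (simp add: algebra_simps)
  ultimately have near: "\<bar>phase r (\<theta> - 2 * pi * of_int q) - 2 * pi * real j\<bar> \<le> pi"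
    by (simp add: n algebra_simps)
  then show ?thesis
    using that[OF j] g_maximal[OF j _ _ near] r z' unfolding r_def by metis
qed

lemma g_mem_max_modulus_set_iff:
  assumes j: "j < k" and r: "0 < r" "r \<le> R"
  shows "g j (of_real r) \<in> max_modulus_set f \<longleftrightarrow> j \<in> winners"
proof -
  have cont: "continuous_on (sphere 0 r) f"
    using R_less r by (intro continuous_on_subset[OF holomorphic_on_imp_continuous_on[OF f_hol]]) auto
  have "g j (of_real r) \<in> max_modulus_set f \<longleftrightarrow>
      (\<forall>w. cmod w = r \<longrightarrow> cmod (f w) \<le> cmod (f (g j (of_real r))))"
    using in_max_modulus_set_iff[of "g j (of_real r)" f] cont cmod_g[OF j r] by simp
  also have "\<dots> \<longleftrightarrow> (\<forall>i<k. cmod (f (g i (of_real r))) \<le> cmod (f (g j (of_real r))))"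
  proof (intro iffI allI impI)
    fix w :: complex
    assume max: "\<forall>i<k. cmod (f (g i (of_real r))) \<le> cmod (f (g j (of_real r)))" and w: "cmod w = r"
    obtain i where "i < k" "w = g i (of_real (cmod w)) \<or> cmod (f w) < cmod (f (g i (of_real (cmod w))))"
      using circle_maximal[of w] w r by blast
    then have "cmod (f w) \<le> cmod (f (g i (of_real r)))"
      unfolding w by auto
    then show "cmod (f w) \<le> cmod (f (g j (of_real r)))"
      using max \<open>i < k\<close> by (meson order.trans)
  qed (use cmod_g r in auto)
  also have "\<dots> \<longleftrightarrow> j \<in> winners"
    using rank[OF _ j r] j by (auto simp: winners_def)
  finally show ?thesis .
qed

lemma max_modulus_set_eq_Union_curves:
  "max_modulus_set f \<inter> {z. 0 < cmod z \<and> cmod z \<le> R} = (\<Union>j\<in>winners. curve j)"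
proof (intro set_eqI iffI)
  fix z assume z: "z \<in> max_modulus_set f \<inter> {z. 0 < cmod z \<and> cmod z \<le> R}"
  then have r: "0 < cmod z" "cmod z \<le> R"
    by auto
  have "continuous_on (sphere 0 (cmod z)) f"
    using R_less r by (intro continuous_on_subset[OF holomorphic_on_imp_continuous_on[OF f_hol]]) auto
  then have max: "\<And>w. cmod w = cmod z \<Longrightarrow> cmod (f w) \<le> cmod (f z)"
    using z in_max_modulus_set_iff by blast
  obtain j where j: "j < k" "z = g j (of_real (cmod z)) \<or> cmod (f z) < cmod (f (g j (of_real (cmod z))))"
    using circle_maximal[OF r] by blast
  then have "z = g j (of_real (cmod z))"
    using max[OF cmod_g[OF j(1) r]] by auto
  then show "z \<in> (\<Union>j\<in>winners. curve j)"
    using mem_curve_iff[OF j(1)] g_mem_max_modulus_set_iff[OF j(1) r] r z j(1) by auto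
next
  fix z assume "z \<in> (\<Union>j\<in>winners. curve j)"
  then obtain j where j: "j \<in> winners" "z \<in> curve j"
    by blast
  then have "j < k"
    by (simp add: winners_def)
  then show "z \<in> max_modulus_set f \<inter> {z. 0 < cmod z \<and> cmod z \<le> R}"
    using j mem_curve_iff g_mem_max_modulus_set_iff by (metis (mono_tags, lifting) IntI mem_Collect_eq)
qed

lemma curve_angle:
  assumes "j < k" "z \<in> curve j"
  shows "is_Arg z (angle j z)"
  unfolding is_Arg_iff_rcis using assms mem_curve_iff g_eq_rcis by metis

text \<open>
  At a common point the two arguments would differ by \<open>\<omega>\<^sub>i - \<omega>\<^sub>j\<close>, which is less than \<open>2 \<pi>\<close> in
  absolute value, so that \<open>\<omega>\<^sub>i = \<omega>\<^sub>j\<close>.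
\<close>

lemma curves_disjoint: "disjoint_family_on curve {..<k}"
  unfolding disjoint_family_on_def
proof (intro ballI impI, rule ccontr)
  fix i j assume ij: "i \<in> {..<k}" "j \<in> {..<k}" "i \<noteq> j" "curve i \<inter> curve j \<noteq> {}"
  then obtain z where "z \<in> curve i" "z \<in> curve j"
    by blast
  then have r: "0 < cmod z" "cmod z \<le> R" "z = g i (of_real (cmod z))" "z = g j (of_real (cmod z))"
    using mem_curve_iff ij by auto
  have arg: "is_Arg z (angle i z)" "is_Arg z (angle j z)"
    using curve_angle ij(1,2) \<open>z \<in> curve i\<close> \<open>z \<in> curve j\<close> by auto
  have diff: "real k * (angle i z - angle j z) = 2 * pi * (real i - real j)"
    using k_angle[of i] k_angle[of j] unfolding angle_def right_diff_distrib by linarith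
  have "real k * \<bar>angle i z - angle j z\<bar> = 2 * pi * \<bar>real i - real j\<bar>"
    using arg_cong[OF diff, of abs] by (simp add: abs_mult)
  also have "\<dots> < real k * (2 * pi)"
    using ij(1,2) by (simp add: mult.commute abs_if)
  finally have "\<bar>angle i z - angle j z\<bar> < 2 * pi"
    using k_pos by simp
  then have "angle i z = angle j z"
    using arg r(1) by (intro is_Arg_eqI[of z]) auto
  then show False
    using ij(3) diff by simp
qed

lemma curve_analytic:
  assumes j: "j < k"
  shows "analytic_curve (curve j)"
  unfolding analytic_curve_def
proof (intro exI conjI ballI)
  have sub: "complex_of_real ` {0<..R} \<subseteq> ball 0 \<delta>"
    using R by auto
  show "is_interval {0<..R}"
    by (simp add: is_interval_convex_1)
  show "interior {0<..R} \<noteq> {}"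
  proof -
    have "{0<..<R} \<subseteq> interior {0<..R}"
      by (intro interior_maximal) auto
    moreover have "R / 2 \<in> {0<..<R}"
      using R by simp
    ultimately show ?thesis
      by (metis empty_iff subsetD)
  qed
  show "g j analytic_on complex_of_real ` {0<..R}"
    using g_hol[OF j] sub by (meson analytic_on_open analytic_on_subset open_ball)
  show "inj_on (g j) (complex_of_real ` {0<..R})"
    using g_inj[OF j] sub inj_on_subset by blast
  show "deriv (g j) (of_real t) \<noteq> 0" if "t \<in> {0<..R}" for t
    using that R by (intro holomorphic_injective_imp_regular[OF g_hol[OF j] open_ball g_inj[OF j]]) auto
  show "curve j = g j ` complex_of_real ` {0<..R}"
    by (rule curve_def)
qed

lemma E_has_derivative: "(E has_field_derivative deriv E 0) (at 0)"
  using E_hol R R_less by (intro holomorphic_derivI[of _ "ball 0 \<rho>"]) auto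

lemma curve_tangent:
  assumes j: "j < k"
  shows "tangent_at_origin_to_ray (curve j) (\<omega> j)"
  unfolding tangent_at_origin_to_ray_def
proof
  show "0 islimpt curve j"
    unfolding islimpt_approachable
  proof (intro allI impI)
    fix e :: real assume "e > 0"
    define r where "r = min (e / 2) R"
    have r: "0 < r" "r \<le> R" "r < e"
      using \<open>e > 0\<close> R by (auto simp: r_def)
    then have "g j (of_real r) \<in> curve j" and mod: "cmod (g j (of_real r)) = r"
      using cmod_g[OF j] by (auto simp: curve_def)
    moreover have "g j (of_real r) \<noteq> 0"
      using mod r(1) by (metis less_irrefl norm_zero)
    ultimately show "\<exists>x'\<in>curve j. x' \<noteq> 0 \<and> dist x' 0 < e"
      using r(3) by (intro bexI[of _ "g j (of_real r)"]) simp_all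
  qed
  have "isCont E 0"
    by (rule DERIV_isCont[OF E_has_derivative])
  then have "((\<lambda>z. cis (angle j z)) \<longlongrightarrow> cis (\<omega> j)) (at 0)"
    unfolding angle_def isCont_def using k_pos by (auto intro!: tendsto_eq_intros simp: E_0)
  then have "((\<lambda>z. cis (angle j z)) \<longlongrightarrow> cis (\<omega> j)) (at 0 within curve j)"
    by (rule tendsto_within_subset) simp
  moreover have "sgn z = cis (angle j z)" if "z \<in> curve j" for z
  proof -
    have "z = of_real (cmod z) * cis (angle j z)" "z \<noteq> 0"
      using curve_angle[OF j that] mem_curve_iff[OF j, of z] that by (auto simp: is_Arg_iff_rcis rcis_def)
    then show ?thesis
      by (metis sgn_eq nonzero_mult_div_cancel_left norm_eq_zero of_real_eq_0_iff)
  qed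
  then have "\<forall>\<^sub>F z in at 0 within curve j. cis (angle j z) = sgn z"
    by (auto simp: eventually_at_filter)
  ultimately show "(sgn \<longlongrightarrow> cis (\<omega> j)) (at 0 within curve j)"
    by (rule Lim_transform_eventually)
qed

text \<open>
  The deviation of the angle is in fact \<open>O(\<bar>z\<bar>)\<close>, as \<open>E\<close> is differentiable at \<open>0\<close> and vanishes
  there.
\<close>

lemma angle_bigo:
  "(\<lambda>z. angle j z - \<omega> j) \<in> O[at 0 within curve j](\<lambda>z. cmod z powr (1/2))"
proof -
  have "((\<lambda>z. E z / z) \<longlongrightarrow> deriv E 0) (at 0)"
    using E_has_derivative by (simp add: has_field_derivative_iff E_0)
  then have "E \<in> O[at 0](\<lambda>z. z)"
    by (intro bigoI_tendsto[of _ _ "deriv E 0"]) (auto simp: eventually_at_filter)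
  then obtain c where c: "c > 0" "\<forall>\<^sub>F z in at 0. cmod (E z) \<le> c * cmod z"
    by (elim landau_o.bigE) simp
  have "\<forall>\<^sub>F z in at 0. cmod (z::complex) < 1"
    unfolding eventually_at by (intro exI[of _ 1]) auto
  with c(2) have "\<forall>\<^sub>F z in at 0. norm (angle j z - \<omega> j) \<le> c * norm (cmod z powr (1/2))"
  proof eventually_elim
    case (elim z)
    have "norm (angle j z - \<omega> j) = \<bar>Im (E z)\<bar> / real k"
      by (simp add: angle_def)
    also have "\<dots> \<le> \<bar>Im (E z)\<bar> / 1"
      using k_pos by (intro divide_left_mono) auto
    also have "\<dots> \<le> cmod (E z)"
      using abs_Im_le_cmod by simp
    also have "\<dots> \<le> c * cmod z"
      by (rule elim)
    also have "\<dots> \<le> c * (cmod z powr (1/2))"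
    proof -
      have "cmod z powr 1 \<le> cmod z powr (1/2)"
        using elim by (intro powr_mono') auto
      then show ?thesis
        using c(1) by simp
    qed
    finally show ?case
      by simp
  qed
  then have "(\<lambda>z. angle j z - \<omega> j) \<in> O[at 0](\<lambda>z. cmod z powr (1/2))"
    by (rule bigoI)
  then show ?thesis
    by (rule landau_o.big.filter_mono[rotated]) (simp add: at_le)
qed

text \<open>
  The characterisation of the curve as the maximum modulus set of a sector involves only \<open>f\<close> and the
  sector, so it is carried along by a rotation that preserves \<open>f\<close>.
\<close>

lemma curve_rotation:
  assumes j: "j < k" and j': "j' < k" and shift: "\<omega> j' = \<omega> j + \<beta>"
    and inv: "\<And>z. f (cis \<beta> * z) = f z"
  shows "curve j' = (\<lambda>z. cis \<beta> * z) ` curve j"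
proof -
  have "curve j' = max_modulus_set_on f ((\<lambda>z. cis \<beta> * z) ` sector (\<omega> j) R half_angle)"
    by (simp only: curve_eq_max_modulus_set_on[OF j'] shift rotate_sector)
  also have "\<dots> = (\<lambda>z. cis \<beta> * z) ` max_modulus_set_on f (sector (\<omega> j) R half_angle)"
    by (rule rotate_max_modulus_set_on) (auto simp: inv)
  finally show ?thesis
    by (simp only: curve_eq_max_modulus_set_on[OF j])
qed

lemma winners_rotation:
  assumes j: "j < k" and j': "j' < k" and shift: "\<omega> j' = \<omega> j + \<beta>"
    and inv: "\<And>z. f (cis \<beta> * z) = f z"
  shows "j' \<in> winners \<longleftrightarrow> j \<in> winners"
proof -
  have RR: "0 < R" "R \<le> R"
    using R by auto
  have "cis \<beta> * g j (of_real R) \<in> curve j'"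
    unfolding curve_rotation[OF assms] using RR by (auto simp: curve_def)
  then have eq: "cis \<beta> * g j (of_real R) = g j' (of_real R)"
    using mem_curve_iff[OF j'] cmod_g[OF j RR] by (simp add: norm_mult)
  have "cis \<beta> * z \<in> max_modulus_set f \<longleftrightarrow> z \<in> max_modulus_set f" for z
    by (simp add: max_modulus_set_def inv norm_mult)
  then show ?thesis
    using g_mem_max_modulus_set_iff[OF j RR] g_mem_max_modulus_set_iff[OF j' RR] eq by metis
qed

end

section \<open>The structure of the maximum modulus set near the origin\<close>

theorem theorem1p4:
  fixes f :: "complex \<Rightarrow> complex" and a :: complex and k :: nat and \<alpha> :: real
  assumes "f holomorphic_on UNIV"
    and "k \<ge> 1" and "a \<noteq> 0"
    and "\<exists>h. h holomorphic_on UNIV \<and> (\<forall>z. f z = 1 + a * z ^ k + z ^ (k + 1) * h z)"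
    and "is_Arg a \<alpha>"
  shows "\<exists>(R::real) (J::nat set) (\<gamma> :: nat \<Rightarrow> complex set).
      R > 0 \<and> J \<subseteq> {..<k} \<and>
      (\<forall>j<k. analytic_curve (\<gamma> j)) \<and>
      disjoint_family_on \<gamma> {..<k} \<and>
      max_modulus_set f \<inter> {z. 0 < cmod z \<and> cmod z \<le> R} = (\<Union>j\<in>J. \<gamma> j) \<and>
      (\<exists>\<phi>>0. \<forall>j<k. \<gamma> j = max_modulus_set_on f (sector (ray_angle k \<alpha> j) R \<phi>)) \<and>
      (\<forall>j<k. \<forall>r. 0 < r \<and> r \<le> R \<longrightarrow> (\<exists>!z. z \<in> \<gamma> j \<and> cmod z = r)) \<and>
      (\<forall>j<k. tangent_at_origin_to_ray (\<gamma> j) (ray_angle k \<alpha> j) \<and>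
        (\<exists>\<theta>. (\<forall>z\<in>\<gamma> j. is_Arg z (\<theta> z)) \<and>
             (\<lambda>z. \<theta> z - ray_angle k \<alpha> j) \<in> O[at 0 within \<gamma> j](\<lambda>z. cmod z powr (1/2)))) \<and>
      inner_degree f dvd card J \<and>
      (\<forall>j<k. \<forall>j'<k. \<forall>m<inner_degree f.
        real j' = real j + real m * real k / real (inner_degree f) \<longrightarrow>
          \<gamma> j' = (\<lambda>z. exp (2 * pi * \<i> * real m / real (inner_degree f)) * z) ` \<gamma> j \<and>
          (j' \<in> J \<longleftrightarrow> j \<in> J))"
proof -
  note k = assms(2)
  obtain h where h: "h holomorphic_on UNIV" and f: "\<And>z. f z = 1 + a * z ^ k + z ^ (k + 1) * h z"
    using assms(4) by blast
  obtain \<rho> E where \<rho>: "\<rho> > 0" and E: "E holomorphic_on ball 0 \<rho>" "E 0 = 0"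
    and nf: "\<And>z. z \<in> ball 0 \<rho> \<Longrightarrow> f z \<noteq> 0"
      "\<And>z. z \<in> ball 0 \<rho> \<Longrightarrow> z * deriv f z = f z * (of_nat k * a * z ^ k * exp (E z))"
      "\<And>z. z \<in> ball 0 \<rho> \<Longrightarrow> \<bar>Im (E z)\<bar> < pi / 2"
      "\<And>z. z \<in> ball 0 \<rho> \<Longrightarrow> cmod (z * deriv E z) < 1"
    using logarithmic_derivative_normal_form[OF f h k assms(3)] by blast
  have normal: "angular_normal_form f E a k \<alpha> \<rho>"
    by unfold_locales (use assms E nf holomorphic_on_subset in auto)
  \<comment> \<open>The curves solve \<open>arg z + Im (E z) / k = \<omega>\<^sub>j\<close>, which is \<open>phase = 2 \<pi> j\<close> divided by \<open>k\<close>.\<close>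
  have "\<exists>d g. d > 0 \<and> g holomorphic_on ball 0 d \<and> inj_on g (ball 0 d) \<and>
      (\<forall>z\<in>ball 0 d. g z \<in> ball 0 \<rho>) \<and>
      (\<forall>r. 0 < r \<longrightarrow> r < d \<longrightarrow>
        g (of_real r) = rcis r (ray_angle k \<alpha> j - Im (E (g (of_real r))) / real k))" for j
  proof -
    have "(\<lambda>z. E z / of_nat k) holomorphic_on ball 0 \<rho>" "E 0 / of_nat k = 0"
      using E k by (auto intro!: holomorphic_intros)
    then obtain d g where "d > 0" "g holomorphic_on ball 0 d" "inj_on g (ball 0 d)"
      "\<And>z. z \<in> ball 0 d \<Longrightarrow> g z \<in> ball 0 \<rho>"
      "\<And>r. 0 < r \<Longrightarrow> r < d \<Longrightarrow>
         g (of_real r) = rcis r (ray_angle k \<alpha> j - Im (E (g (of_real r)) / of_nat k))"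
      by (rule level_curve_of_twisted_argument[OF _ _ \<rho>, where \<omega> = "ray_angle k \<alpha> j"])
        (rule that)
    then show ?thesis
      by (intro exI[of _ d] exI[of _ g]) auto
  qed
  then obtain d g where d: "\<And>j. d j > 0" and g_hol: "\<And>j. g j holomorphic_on ball 0 (d j)"
    and g_inj: "\<And>j. inj_on (g j) (ball 0 (d j))"
    and g_ball: "\<And>j z. z \<in> ball 0 (d j) \<Longrightarrow> g j z \<in> ball 0 \<rho>"
    and g_polar: "\<And>j r. 0 < r \<Longrightarrow> r < d j \<Longrightarrow>
        g j (of_real r) = rcis r (ray_angle k \<alpha> j - Im (E (g j (of_real r))) / real k)"
    by metis
  define below where "below = (\<lambda>i j r. cmod (f (g i (complex_of_real r))) \<le> cmod (f (g j (of_real r))))"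
  have "\<exists>b. \<forall>\<^sub>F r in at_right 0. below i j r = b" for i j
  proof -
    define e where "e = min (d i) (d j)"
    have fg: "(\<lambda>z. f (g l z)) holomorphic_on ball 0 e" if "l \<in> {i, j}" for l
    proof -
      have "ball 0 e \<subseteq> ball (0::complex) (d l)"
        using that by (auto simp: e_def)
      then have "g l holomorphic_on ball 0 e"
        by (rule holomorphic_on_subset[OF g_hol])
      then show ?thesis
        using holomorphic_on_compose_gen[OF _ assms(1)] by (simp add: o_def)
    qed
    have "(\<forall>\<^sub>F r in at_right 0. below i j r) \<or> (\<forall>\<^sub>F r in at_right 0. \<not> below i j r)"
      unfolding below_def not_le
      using d by (intro cmod_comparison_eventually_constant[of _ e]) (auto simp: fg, auto simp: e_def)
    then show ?thesis
    proof
      assume "\<forall>\<^sub>F r in at_right 0. below i j r"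
      then show ?thesis
        by (intro exI[of _ True]) simp
    next
      assume "\<forall>\<^sub>F r in at_right 0. \<not> below i j r"
      then show ?thesis
        by (intro exI[of _ False]) simp
    qed
  qed
  then obtain b where b: "\<And>i j. \<forall>\<^sub>F r in at_right 0. below i j r = b i j"
    by metis
  \<comment> \<open>Only finitely many pairs of curves have to be compared, so one radius serves all of them.\<close>
  have "\<forall>\<^sub>F r in at_right 0. \<forall>i\<in>{..<k}. \<forall>j\<in>{..<k}. below i j r = b i j"
    by (intro eventually_ball_finite ballI b) auto
  then obtain e where e: "e > 0" "\<And>r i j. 0 < r \<Longrightarrow> r < e \<Longrightarrow> i < k \<Longrightarrow> j < k \<Longrightarrow> below i j r = b i j"
    by (auto simp: eventually_at_right_field)
  define \<delta> where "\<delta> = Min (d ` {..<k})"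
  have "\<delta> \<in> d ` {..<k}"
    unfolding \<delta>_def using k by (intro Min_in) (auto simp: lessThan_empty_iff)
  then have \<delta>: "\<delta> > 0" "\<And>j. j < k \<Longrightarrow> \<delta> \<le> d j"
    using d by (auto simp: \<delta>_def)
  define R where "R = min e \<delta> / 2"
  have R: "0 < R" "R < \<delta>" "R < e"
    using e(1) \<delta>(1) by (auto simp: R_def)
  interpret critical_curves f E a k \<alpha> \<rho> g R \<delta>
  proof (intro critical_curves.intro normal, unfold_locales)
    show "0 < R" "R < \<delta>"
      by fact+
    fix i j r assume j: "j < k"
    show "g j holomorphic_on ball 0 \<delta>" "inj_on (g j) (ball 0 \<delta>)"
      using g_hol[of j] g_inj[of j] \<delta>(2)[OF j]
      by (auto intro: holomorphic_on_subset inj_on_subset)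
    assume r: "0 < r" "r \<le> R"
    show "g j (of_real r) \<in> ball 0 \<rho>"
      using \<delta>(2)[OF j] r R(2) by (intro g_ball) auto
    show "g j (of_real r) = rcis r (ray_angle k \<alpha> j - Im (E (g j (of_real r))) / real k)"
      using \<delta>(2)[OF j] r R(2) by (intro g_polar) auto
    assume "i < k"
    then show "cmod (f (g i (of_real r))) \<le> cmod (f (g j (of_real r))) \<longleftrightarrow>
        cmod (f (g i (of_real R))) \<le> cmod (f (g j (of_real R)))"
      using e(2)[of r i j] e(2)[of R i j] r R j by (simp add: below_def)
  qed
  define \<mu> where "\<mu> = inner_degree f"
  have \<mu>: "\<mu> \<ge> 1" "\<mu> dvd k" and inv: "\<And>m z. f (cis (2 * pi * real m / real \<mu>) * z) = f z"
    unfolding \<mu>_def using inner_degree_properties[OF f h assms(3) k] by blast+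
  have shift: "\<omega> j' = \<omega> j + 2 * pi * real m / real \<mu>"
    if "real j' = real j + real m * real k / real \<mu>" for j j' m
  proof -
    have "2 * real j' * pi - \<alpha> = (2 * real j * pi - \<alpha>) + real k * (2 * pi * real m / real \<mu>)"
      unfolding that by (simp add: algebra_simps)
    then show ?thesis
      using k unfolding ray_angle_def by (simp only: add_divide_distrib) simp
  qed
  have periodic: "curve j' = (\<lambda>z. exp (2 * pi * \<i> * real m / real \<mu>) * z) ` curve j \<and>
      (j' \<in> winners \<longleftrightarrow> j \<in> winners)"
    if "j < k" "j' < k" "real j' = real j + real m * real k / real \<mu>" for j j' m
  proof -
    have "exp (2 * pi * \<i> * real m / real \<mu>) = cis (2 * pi * real m / real \<mu>)"
      by (simp add: cis_conv_exp mult_ac)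
    then show ?thesis
      using curve_rotation[OF that(1,2) shift[OF that(3)] inv]
        winners_rotation[OF that(1,2) shift[OF that(3)] inv] by simp
  qed
  have dvd: "\<mu> dvd card winners"
  proof (rule dvd_card_of_periodic)
    have kd: "\<mu> * (k div \<mu>) = k"
      using \<mu>(2) by simp
    show "winners \<subseteq> {..<\<mu> * (k div \<mu>)}"
      unfolding kd by (auto simp: winners_def)
    fix i m assume im: "i < k div \<mu>" "m < \<mu>"
    have "i + m * (k div \<mu>) < Suc m * (k div \<mu>)"
      using im(1) by simp
    also have "\<dots> \<le> \<mu> * (k div \<mu>)"
      using im(2) by (intro mult_right_mono) auto
    finally have "i + m * (k div \<mu>) < k"
      by (simp only: kd)
    moreover from this have "i < k"
      by simp
    moreover have "real (k div \<mu>) = real k / real \<mu>"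
      using \<mu>(2) by (rule real_of_nat_div)
    ultimately show "i + m * (k div \<mu>) \<in> winners \<longleftrightarrow> i \<in> winners"
      using periodic[of i "i + m * (k div \<mu>)" m] by simp
  qed
  have unique: "\<exists>!z. z \<in> curve j \<and> cmod z = r" if "j < k" "0 < r" "r \<le> R" for j r
  proof (rule ex1I[of _ "g j (of_real r)"])
    show "g j (of_real r) \<in> curve j \<and> cmod (g j (of_real r)) = r"
      using that cmod_g[OF that] by (simp add: curve_def)
    show "z = g j (of_real r)" if "z \<in> curve j \<and> cmod z = r" for z
      using mem_curve_iff[OF \<open>j < k\<close>, of z] that by metis
  qed
  show ?thesis
  proof (rule exI[of _ R], rule exI[of _ winners], rule exI[of _ curve], intro conjI)
    show "0 < R"
      by (rule R(1))
    show "winners \<subseteq> {..<k}"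
      by (auto simp: winners_def)
    show "\<forall>j<k. analytic_curve (curve j)"
      using curve_analytic by simp
    show "disjoint_family_on curve {..<k}"
      by (rule curves_disjoint)
    show "max_modulus_set f \<inter> {z. 0 < cmod z \<and> cmod z \<le> R} = (\<Union>j\<in>winners. curve j)"
      by (rule max_modulus_set_eq_Union_curves)
    show "\<exists>\<phi>>0. \<forall>j<k. curve j = max_modulus_set_on f (sector (\<omega> j) R \<phi>)"
      by (rule exI[of _ half_angle]) (simp add: half_angle_pos curve_eq_max_modulus_set_on)
    show "\<forall>j<k. \<forall>r. 0 < r \<and> r \<le> R \<longrightarrow> (\<exists>!z. z \<in> curve j \<and> cmod z = r)"
      using unique by blast
    show "\<forall>j<k. tangent_at_origin_to_ray (curve j) (\<omega> j) \<and>
        (\<exists>\<theta>. (\<forall>z\<in>curve j. is_Arg z (\<theta> z)) \<and>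
             (\<lambda>z. \<theta> z - \<omega> j) \<in> O[at 0 within curve j](\<lambda>z. cmod z powr (1/2)))"
    proof (intro allI impI conjI exI ballI)
      fix j assume j: "j < k"
      show "tangent_at_origin_to_ray (curve j) (\<omega> j)"
        by (rule curve_tangent[OF j])
      show "is_Arg z (angle j z)" if "z \<in> curve j" for z
        by (rule curve_angle[OF j that])
      show "(\<lambda>z. angle j z - \<omega> j) \<in> O[at 0 within curve j](\<lambda>z. cmod z powr (1/2))"
        by (rule angle_bigo)
    qed
    show "inner_degree f dvd card winners"
      using dvd by (simp only: \<mu>_def)
    show "\<forall>j<k. \<forall>j'<k. \<forall>m<inner_degree f.
        real j' = real j + real m * real k / real (inner_degree f) \<longrightarrow>
          curve j' = (\<lambda>z. exp (2 * pi * \<i> * real m / real (inner_degree f)) * z) ` curve j \<and>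
          (j' \<in> winners \<longleftrightarrow> j \<in> winners)"
      unfolding \<mu>_def[symmetric] using periodic by (intro allI impI)
  qed
qed

end
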